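(* Let $n\ge2$, let $F\subseteq\mathbb{R}^n$ be closed and convex, and let $a\ne b$ be points of $F$. Then $\eta(a,b)$ holds in $F$ if and only if the ray $\{a+t(b-a):t\ge0\}$ is not contained in $F$; equivalently, $\neg\eta(a,b)$ holds in $F$ if and only if $b-a\in\operatorname{rec}F$.
   Context: A convex set $F\subseteq\mathbb{R}^n$ is a structure for the first-order language $\mathcal{L}_{\mathrm{B}}$ with one ternary relation symbol $B$: the universe is $F$ and $B(a,x,b)$ holds iff $x\in[a,b]$ (the closed segment). $\eta(a,b)$ is the $\mathcal{L}_{\mathrm{B}}$-formula $a\ne b\wedge\exists c\,\bigl(B(a,b,c)\wedge\forall d\,(B(a,c,d)\to d=c)\bigr)$, with quantifiers ranging over $F$. The recession cone is $\operatorname{rec}F=\{v\in\mathbb{R}^n:x+tv\in F\text{ for all }x\in F,\ t\ge0\}$. *)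

theory Defs
  imports "HOL-Analysis.Analysis"
begin

text \<open>First-order formulas, with equality, over a signature consisting of one ternary relation
  symbol. Variables are named by natural numbers, and a quantifier binds the name it carries.\<close>

datatype bform =
    Eq nat nat
  | Bet nat nat nat
  | Neg bform
  | Conj bform bform
  | Imp bform bform
  | All nat bform
  | Exi nat bform

text \<open>Satisfaction in a structure with universe \<open>U\<close> and interpretation \<open>R\<close> of the relation
  symbol, under an assignment \<open>s\<close> of elements to variables.\<close>

primrec sat :: "'a set \<Rightarrow> ('a \<Rightarrow> 'a \<Rightarrow> 'a \<Rightarrow> bool) \<Rightarrow> (nat \<Rightarrow> 'a) \<Rightarrow> bform \<Rightarrow> bool" where
  "sat U R s (Eq x y) \<longleftrightarrow> s x = s y"
| "sat U R s (Bet x y z) \<longleftrightarrow> R (s x) (s y) (s z)"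
| "sat U R s (Neg p) \<longleftrightarrow> \<not> sat U R s p"
| "sat U R s (Conj p q) \<longleftrightarrow> sat U R s p \<and> sat U R s q"
| "sat U R s (Imp p q) \<longleftrightarrow> (sat U R s p \<longrightarrow> sat U R s q)"
| "sat U R s (All x p) \<longleftrightarrow> (\<forall>u\<in>U. sat U R (s(x := u)) p)"
| "sat U R s (Exi x p) \<longleftrightarrow> (\<exists>u\<in>U. sat U R (s(x := u)) p)"

definition betw :: "'a::real_vector \<Rightarrow> 'a \<Rightarrow> 'a \<Rightarrow> bool" where
  "betw a x b \<longleftrightarrow> x \<in> closed_segment a b"

text \<open>The variables 0, 1, 2, 3 stand for \<open>a\<close>, \<open>b\<close>, \<open>c\<close>, \<open>d\<close>; 0 and 1 are free.\<close>

definition eta :: bform where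
  "eta = Conj (Neg (Eq 0 1))
          (Exi 2 (Conj (Bet 0 1 2) (All 3 (Imp (Bet 0 2 3) (Eq 3 2)))))"

text \<open>Truth in the structure \<open>F\<close> of a formula whose free variables are among 0 and 1, at
  \<open>(a, b)\<close>. The value given to the remaining variables is irrelevant for such a formula.\<close>

definition holds_in :: "'a::real_vector set \<Rightarrow> bform \<Rightarrow> 'a \<Rightarrow> 'a \<Rightarrow> bool" where
  "holds_in F p a b \<longleftrightarrow> sat F betw (\<lambda>i. if i = 0 then a else b) p"

definition rec_cone :: "'a::real_vector set \<Rightarrow> 'a set" where
  "rec_cone F = {v. \<forall>x\<in>F. \<forall>t::real. t \<ge> 0 \<longrightarrow> x + t *\<^sub>R v \<in> F}"

end

theory Submission
  imports Defs
begin

text \<open>On the ray from \<open>a\<close> through \<open>b\<close>, the formula says that \<open>F\<close> has a last point: since \<open>F\<close> is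
  closed and convex, the set of parameters \<open>t \<ge> 0\<close> staying in \<open>F\<close> is a closed interval starting at
  0, and it has a maximum exactly when it is bounded. If the ray stays in \<open>F\<close>, then so does the
  parallel ray from any \<open>x \<in> F\<close>, because \<open>x + t(b - a)\<close> is the limit as \<open>n \<rightarrow> \<infinity>\<close> of the points of the
  segments from \<open>x\<close> to \<open>a + nt(b - a)\<close> with parameter \<open>1/n\<close>.\<close>

lemma holds_in_eta:
  "holds_in F eta a b \<longleftrightarrow>
    a \<noteq> b \<and> (\<exists>c\<in>F. b \<in> closed_segment a c \<and> (\<forall>d\<in>F. c \<in> closed_segment a d \<longrightarrow> d = c))"
  by (simp add: holds_in_def eta_def betw_def)

lemma holds_in_Neg: "holds_in F (Neg p) a b \<longleftrightarrow> \<not> holds_in F p a b"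
  by (simp add: holds_in_def)

text \<open>Since \<open>a \<noteq> b\<close>, the parameter \<open>u\<close> of \<open>b\<close> on
  the segment is nonzero, and \<open>t\<close> is its reciprocal. This turns both betweenness
  conditions in \<open>eta\<close> into statements about ray parameters.\<close>

lemma closed_segment_ray:
  fixes a b c :: "'a::real_vector"
  assumes "b \<in> closed_segment a c" and "a \<noteq> b"
  obtains t where "t \<ge> 1" and "c = a + t *\<^sub>R (b - a)"
proof -
  obtain u where u: "0 \<le> u" "u \<le> 1" and "b = (1 - u) *\<^sub>R a + u *\<^sub>R c"
    using assms(1) by (auto simp: in_segment)
  then have b: "b - a = u *\<^sub>R (c - a)"
    by (simp add: algebra_simps)
  with assms(2) have "u \<noteq> 0" by auto
  with b have "c = a + (1 / u) *\<^sub>R (b - a)"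
    by simp
  moreover have "1 / u \<ge> 1"
    using u \<open>u \<noteq> 0\<close> by simp
  ultimately show thesis using that by blast
qed

lemma ray_in_closed_segment:
  fixes a v :: "'a::real_vector"
  assumes "0 \<le> s" and "s \<le> t"
  shows "a + s *\<^sub>R v \<in> closed_segment a (a + t *\<^sub>R v)"
\<comment> \<open>The segment parameter will be \<open>s / t\<close>; for \<open>t = 0\<close> the
  bounds force \<open>s = 0\<close> and both points are \<open>a\<close>.\<close>
proof (cases "t = 0")
  case True
  with assms show ?thesis by simp
next
  case False
  have "a + s *\<^sub>R v = (1 - s / t) *\<^sub>R a + (s / t) *\<^sub>R (a + t *\<^sub>R v)"
    using False by (simp add: algebra_simps)
  moreover have "0 \<le> s / t" "s / t \<le> 1"
    using assms False by (auto simp: divide_simps)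
  ultimately show ?thesis unfolding in_segment by blast
qed

lemma holds_in_eta_iff_ray:
  fixes F :: "'a::real_normed_vector set"
  assumes "closed F" and "convex F" and "a \<in> F" and "b \<in> F" and "a \<noteq> b"
  shows "holds_in F eta a b \<longleftrightarrow> (\<exists>t\<ge>0. a + t *\<^sub>R (b - a) \<notin> F)"
proof
  assume "holds_in F eta a b"
  then obtain c where "b \<in> closed_segment a c"
    and last: "\<And>d. d \<in> F \<Longrightarrow> c \<in> closed_segment a d \<Longrightarrow> d = c"
    unfolding holds_in_eta by blast
  then obtain t where t: "t \<ge> 1" and c: "c = a + t *\<^sub>R (b - a)"
    using closed_segment_ray \<open>a \<noteq> b\<close> by metis
  \<comment> \<open>A point strictly beyond \<open>c\<close> on the ray: if it were in
    \<open>F\<close>, then \<open>c\<close> would not be last.\<close>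
  have "c \<in> closed_segment a (a + (t + 1) *\<^sub>R (b - a))"
    unfolding c using t by (intro ray_in_closed_segment) auto
  moreover have "a + (t + 1) *\<^sub>R (b - a) \<noteq> c"
    using \<open>a \<noteq> b\<close> by (simp add: c)
  ultimately have "a + (t + 1) *\<^sub>R (b - a) \<notin> F"
    using last by blast
  then show "\<exists>t\<ge>0. a + t *\<^sub>R (b - a) \<notin> F"
    using t by (intro exI[of _ "t + 1"]) auto
next
  assume "\<exists>t\<ge>0. a + t *\<^sub>R (b - a) \<notin> F"
  then obtain s where s: "s \<ge> 0" "a + s *\<^sub>R (b - a) \<notin> F" by blast
  \<comment> \<open>Negative parameters are allowed in \<open>T\<close>; they are harmless, since
    only its supremum matters.\<close>
  define T where "T = (\<lambda>t. a + t *\<^sub>R (b - a)) -` F"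
  have "closed T"
    unfolding T_def by (intro closed_vimage \<open>closed F\<close> continuous_intros)
  \<comment> \<open>A parameter of \<open>T\<close> beyond \<open>s\<close> would, by convexity,
    bring the missing point at \<open>s\<close> into \<open>F\<close>.\<close>
  have bound: "t \<le> s" if "t \<in> T" for t
  proof (rule ccontr)
    assume "\<not> t \<le> s"
    then have "a + s *\<^sub>R (b - a) \<in> closed_segment a (a + t *\<^sub>R (b - a))"
      using s by (intro ray_in_closed_segment) auto
    also have "\<dots> \<subseteq> F"
      using that assms by (intro closed_segment_subset) (auto simp: T_def)
    finally show False using s by blast
  qed
  then have bdd: "bdd_above T" by (auto simp: bdd_above_def)
  \<comment> \<open>Parameter 1 is the point \<open>b\<close>. It makes \<open>T\<close> nonempty
    and later gives \<open>m \<ge> 1\<close>, which places \<open>b\<close> between \<open>a\<close>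
    and \<open>c\<close>.\<close>
  have "1 \<in> T" using \<open>b \<in> F\<close> by (simp add: T_def)
  define m where "m = Sup T"
  have "m \<in> T"
    unfolding m_def using \<open>1 \<in> T\<close> bdd \<open>closed T\<close> by (intro closed_contains_Sup) auto
  have max: "t \<le> m" if "t \<in> T" for t
    unfolding m_def using that bdd by (rule cSup_upper)
  have "m \<ge> 1" using max \<open>1 \<in> T\<close> by blast
  define c where "c = a + m *\<^sub>R (b - a)"
  have "c \<in> F" using \<open>m \<in> T\<close> by (simp add: T_def c_def)
  moreover have "b \<in> closed_segment a c"
    using ray_in_closed_segment[of 1 m a "b - a"] \<open>m \<ge> 1\<close> by (simp add: c_def)
  moreover have "d = c" if "d \<in> F" and "c \<in> closed_segment a d" for d
  proof -
    \<comment> \<open>Now the ray is taken through \<open>c\<close> instead of \<open>b\<close>: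
      \<open>d\<close> has parameter \<open>t * m\<close> with \<open>t \<ge> 1\<close>, and
      maximality of \<open>m\<close> forces \<open>t * m = m\<close>.\<close>
    have "a \<noteq> c" using \<open>m \<ge> 1\<close> \<open>a \<noteq> b\<close> by (simp add: c_def)
    then obtain t where t: "t \<ge> 1" and "d = a + t *\<^sub>R (c - a)"
      using closed_segment_ray \<open>c \<in> closed_segment a d\<close> by metis
    then have d: "d = a + (t * m) *\<^sub>R (b - a)" by (simp add: c_def)
    then have "t * m \<le> m" using \<open>d \<in> F\<close> by (intro max) (simp add: T_def)
    moreover have "m \<le> t * m" using t \<open>m \<ge> 1\<close> by simp
    ultimately show "d = c" by (simp add: d c_def)
  qed
  ultimately show "holds_in F eta a b"
    unfolding holds_in_eta using \<open>a \<noteq> b\<close> by blast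
qed

lemma rec_cone_iff_ray:
  fixes F :: "'a::real_normed_vector set"
  assumes "closed F" and "convex F" and "a \<in> F"
  shows "v \<in> rec_cone F \<longleftrightarrow> (\<forall>t\<ge>0. a + t *\<^sub>R v \<in> F)"
proof
  assume "v \<in> rec_cone F"
  then show "\<forall>t\<ge>0. a + t *\<^sub>R v \<in> F"
    using \<open>a \<in> F\<close> by (simp add: rec_cone_def)
next
  assume ray: "\<forall>t\<ge>0. a + t *\<^sub>R v \<in> F"
  have "x + t *\<^sub>R v \<in> F" if "x \<in> F" and "t \<ge> 0" for x t
  proof (rule closed_sequentially[OF \<open>closed F\<close>])
    \<comment> \<open>With \<open>u = 1/(n+1)\<close>, this is the point with parameter
      \<open>u\<close> on the segment from \<open>x\<close> to
      \<open>a + (t / u) *\<^sub>R v\<close>, expanded so that the factor \<open>u\<close> cancels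
      on \<open>v\<close> and the limit is visible.\<close>
    let ?y = "\<lambda>n. (x + t *\<^sub>R v) + inverse (real (Suc n)) *\<^sub>R (a - x)"
    show "?y n \<in> F" for n
    proof -
      define u where "u = inverse (real (Suc n))"
      have u: "0 < u" "u \<le> 1" by (auto simp: u_def divide_simps)
      have "(1 - u) *\<^sub>R x + u *\<^sub>R (a + (t / u) *\<^sub>R v) \<in> F"
        using u that ray by (intro convexD[OF \<open>convex F\<close>]) auto
      also have "(1 - u) *\<^sub>R x + u *\<^sub>R (a + (t / u) *\<^sub>R v) = x + t *\<^sub>R v + u *\<^sub>R (a - x)"
        using u by (simp add: algebra_simps)
      finally show ?thesis by (simp only: u_def)
    qed
    have "?y \<longlonglongrightarrow> (x + t *\<^sub>R v) + 0 *\<^sub>R (a - x)"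
      by (intro tendsto_intros LIMSEQ_inverse_real_of_nat)
    then show "?y \<longlonglongrightarrow> x + t *\<^sub>R v" by simp
  qed
  then show "v \<in> rec_cone F" by (simp add: rec_cone_def)
qed

theorem lemma10p8:
  fixes F :: "(real ^ 'n) set" and a b :: "real ^ 'n"
  assumes "CARD('n) \<ge> 2"
    and "closed F" and "convex F"
    and "a \<in> F" and "b \<in> F" and "a \<noteq> b"
  shows "(holds_in F eta a b \<longleftrightarrow> \<not> {a + t *\<^sub>R (b - a) | t. t \<ge> 0} \<subseteq> F) \<and>
         (holds_in F (Neg eta) a b \<longleftrightarrow> b - a \<in> rec_cone F)"
  using holds_in_eta_iff_ray[OF assms(2-6)] rec_cone_iff_ray[OF assms(2-4), of "b - a"]
  by (auto simp: holds_in_Neg)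

end
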